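(* For each $P\subseteq[n]$, the subgroup of $S([n]^2)$ generated by $\check R_P\cup R_P$ is a bicompatible subgroup of $S([n]^2)$ isomorphic to $(S_{n-|P|})^{|P|+1}$. Similarly, the subgroup generated by $\check C_P\cup C_P$ is a bicompatible subgroup of $S([n]^2)$ isomorphic to $(S_{n-|P|})^{|P|+1}$.
   Context: $[n]=\{1,\dots,n\}$; $S(A)$ is the symmetric group on a set $A$, $S_n=S([n])$; permutations are composed right to left. For $u\in S([n]^t)$ and $v\in S([n]^r)$, $u\otimes v\in S([n]^{t+r})$ is $(u\otimes v)(\alpha,\beta)=(u(\alpha),v(\beta))$; $1$ is the identity of $S_n$. For $u,v\in S([n]^2)$, $u$ is compatible with $v$ if $(v\otimes1)(1\otimes u)=(1\otimes u)(v\otimes1)$ in $S([n]^3)$; $u$ and $v$ are bicompatible if $u$ is compatible with $v$ and $v$ is compatible with $u$. A subgroup $S\le S([n]^2)$ is a bicompatible subgroup if $u$ and $v$ are bicompatible for all $u,v\in S$ (including $u=v$). For $P\subseteq[n]$: $R_P\le S([n]^2)$ is the set of $u\in S([n]^2)$ such that (1) $u(\{k\}\times([n]\setminus P))=\{k\}\times([n]\setminus P)$ for each $k\in P$, and (2) $u(k,j)=(k,j)$ if $k\in[n]\setminus P$ or $j\in P$. $\check R_P\le S([n]^2)$ is the set of $u$ such that (1) there is $\sigma\in S([n]\setminus P)$ with $u(k,j)=(k,\sigma(j))$ for all $k,j\in[n]\setminus P$, and (2) $u(k,j)=(k,j)$ if $k\in P$ or $j\in P$. The subgroups $C_P$ and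 $\check C_P$ are defined analogously with columns in place of rows (i.e. with the roles of the two coordinates of $[n]^2$ exchanged). *)

theory Defs
  imports "HOL-Algebra.Bij" "HOL-Algebra.Generated_Groups" "HOL-Algebra.Product_Groups"
begin

text \<open>
  The symmetric group \<open>S(A)\<close> is \<^term>\<open>BijGroup A\<close>. Its elements are functions that are
  extensional on \<open>A\<close>, and its product is composition from right to left.
\<close>

definition square :: "nat \<Rightarrow> (nat \<times> nat) set" where
  "square n = {1..n} \<times> {1..n}"

definition cube :: "nat \<Rightarrow> (nat \<times> nat \<times> nat) set" where
  "cube n = {1..n} \<times> {1..n} \<times> {1..n}"

text \<open>
  The two instances \<open>S([n]\<^sup>2) \<times> S([n]) \<rightarrow> S([n]\<^sup>3)\<close> and \<open>S([n]) \<times> S([n]\<^sup>2) \<rightarrow> S([n]\<^sup>3)\<close> of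
  \<open>(u \<otimes> v)(\<alpha>, \<beta>) = (u \<alpha>, v \<beta>)\<close>, where \<open>[n]\<^sup>2 \<times> [n]\<close> and \<open>[n] \<times> [n]\<^sup>2\<close> are both identified
  with \<open>[n]\<^sup>3\<close> by concatenating tuples.
\<close>

definition tensor21 ::
    "nat \<Rightarrow> (nat \<times> nat \<Rightarrow> nat \<times> nat) \<Rightarrow> (nat \<Rightarrow> nat) \<Rightarrow> nat \<times> nat \<times> nat \<Rightarrow> nat \<times> nat \<times> nat" where
  "tensor21 n u v = (\<lambda>(a, b, c)\<in>cube n. (fst (u (a, b)), snd (u (a, b)), v c))"

definition tensor12 ::
    "nat \<Rightarrow> (nat \<Rightarrow> nat) \<Rightarrow> (nat \<times> nat \<Rightarrow> nat \<times> nat) \<Rightarrow> nat \<times> nat \<times> nat \<Rightarrow> nat \<times> nat \<times> nat" where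
  "tensor12 n u v = (\<lambda>(a, b, c)\<in>cube n. (u a, v (b, c)))"

definition compatible ::
    "nat \<Rightarrow> (nat \<times> nat \<Rightarrow> nat \<times> nat) \<Rightarrow> (nat \<times> nat \<Rightarrow> nat \<times> nat) \<Rightarrow> bool" where
  "compatible n u v \<longleftrightarrow>
     tensor21 n v \<one>\<^bsub>BijGroup {1..n}\<^esub> \<otimes>\<^bsub>BijGroup (cube n)\<^esub> tensor12 n \<one>\<^bsub>BijGroup {1..n}\<^esub> u =
     tensor12 n \<one>\<^bsub>BijGroup {1..n}\<^esub> u \<otimes>\<^bsub>BijGroup (cube n)\<^esub> tensor21 n v \<one>\<^bsub>BijGroup {1..n}\<^esub>"

definition bicompatible ::
    "nat \<Rightarrow> (nat \<times> nat \<Rightarrow> nat \<times> nat) \<Rightarrow> (nat \<times> nat \<Rightarrow> nat \<times> nat) \<Rightarrow> bool" where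
  "bicompatible n u v \<longleftrightarrow> compatible n u v \<and> compatible n v u"

definition bicompatible_subgroup :: "nat \<Rightarrow> (nat \<times> nat \<Rightarrow> nat \<times> nat) set \<Rightarrow> bool" where
  "bicompatible_subgroup n S \<longleftrightarrow>
     subgroup S (BijGroup (square n)) \<and> (\<forall>u\<in>S. \<forall>v\<in>S. bicompatible n u v)"

definition R :: "nat \<Rightarrow> nat set \<Rightarrow> (nat \<times> nat \<Rightarrow> nat \<times> nat) set" where
  "R n P = {u \<in> carrier (BijGroup (square n)).
     (\<forall>k\<in>P. u ` ({k} \<times> ({1..n} - P)) = {k} \<times> ({1..n} - P)) \<and>
     (\<forall>k\<in>{1..n}. \<forall>j\<in>{1..n}. k \<in> {1..n} - P \<or> j \<in> P \<longrightarrow> u (k, j) = (k, j))}"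

definition R_check :: "nat \<Rightarrow> nat set \<Rightarrow> (nat \<times> nat \<Rightarrow> nat \<times> nat) set" where
  "R_check n P = {u \<in> carrier (BijGroup (square n)).
     (\<exists>\<sigma>\<in>carrier (BijGroup ({1..n} - P)).
        \<forall>k\<in>{1..n} - P. \<forall>j\<in>{1..n} - P. u (k, j) = (k, \<sigma> j)) \<and>
     (\<forall>k\<in>{1..n}. \<forall>j\<in>{1..n}. k \<in> P \<or> j \<in> P \<longrightarrow> u (k, j) = (k, j))}"

definition C :: "nat \<Rightarrow> nat set \<Rightarrow> (nat \<times> nat \<Rightarrow> nat \<times> nat) set" where
  "C n P = {u \<in> carrier (BijGroup (square n)).
     (\<forall>k\<in>P. u ` (({1..n} - P) \<times> {k}) = ({1..n} - P) \<times> {k}) \<and>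
     (\<forall>k\<in>{1..n}. \<forall>j\<in>{1..n}. k \<in> {1..n} - P \<or> j \<in> P \<longrightarrow> u (j, k) = (j, k))}"

definition C_check :: "nat \<Rightarrow> nat set \<Rightarrow> (nat \<times> nat \<Rightarrow> nat \<times> nat) set" where
  "C_check n P = {u \<in> carrier (BijGroup (square n)).
     (\<exists>\<sigma>\<in>carrier (BijGroup ({1..n} - P)).
        \<forall>k\<in>{1..n} - P. \<forall>j\<in>{1..n} - P. u (j, k) = (\<sigma> j, k)) \<and>
     (\<forall>k\<in>{1..n}. \<forall>j\<in>{1..n}. k \<in> P \<or> j \<in> P \<longrightarrow> u (j, k) = (j, k))}"

definition sym_power :: "nat \<Rightarrow> nat \<Rightarrow> (nat \<Rightarrow> nat \<Rightarrow> nat) monoid" where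
  "sym_power m k = product_group {1..k} (\<lambda>_. BijGroup {1..m})"

end

theory Submission
  imports Defs
begin

text \<open>
  The group generated by \<open>R_check n P \<union> R n P\<close> consists of the permutations
  \<open>(k, j) \<mapsto> (k, f\<^sub>k j)\<close> for \<open>j \<notin> P\<close>, fixing \<open>(k, j)\<close> for \<open>j \<in> P\<close>, where the
  \<open>f\<^sub>k \<in> S([n] - P)\<close> are arbitrary for \<open>k \<in> P\<close> and all equal to one permutation \<open>f\<^sub>0\<close> for
  \<open>k \<notin> P\<close>. Two of them are compatible because applying one to \<open>(a, b)\<close> does not change which
  member of the other family acts in row \<open>b\<close>: either \<open>b \<in> P\<close> is fixed, or \<open>b\<close> stays outside \<open>P\<close>.
  Columns reduce to rows by conjugating with the swap of coordinates.
\<close>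

section \<open>Symmetric groups and powers of a group\<close>

lemma BijGroup_one: "x \<in> S \<Longrightarrow> \<one>\<^bsub>BijGroup S\<^esub> x = x"
  by (simp add: BijGroup_def)

lemma BijGroup_mult:
  "\<lbrakk>u \<in> carrier (BijGroup S); v \<in> carrier (BijGroup S); x \<in> S\<rbrakk>
    \<Longrightarrow> (u \<otimes>\<^bsub>BijGroup S\<^esub> v) x = u (v x)"
  by (simp add: BijGroup_def compose_def)

lemma carrier_BijGroup_iff:
  "u \<in> carrier (BijGroup S) \<longleftrightarrow> u \<in> extensional S \<and> bij_betw u S S"
  by (simp add: BijGroup_def Bij_def)

lemma BijGroup_closed: "\<lbrakk>u \<in> carrier (BijGroup S); x \<in> S\<rbrakk> \<Longrightarrow> u x \<in> S"
  by (auto simp: carrier_BijGroup_iff bij_betw_def)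

lemma BijGroup_eqI:
  "\<lbrakk>u \<in> carrier (BijGroup S); v \<in> carrier (BijGroup S); \<And>x. x \<in> S \<Longrightarrow> u x = v x\<rbrakk> \<Longrightarrow> u = v"
  by (auto simp: carrier_BijGroup_iff intro: extensionalityI)

text \<open>In a product of two conjugates the inner \<open>k\<close> and \<open>h\<close> cancel,
  and conjugating back with \<open>h\<close> and \<open>k\<close> exchanged is the inverse map. The
  result serves twice: to relabel a symmetric group along a bijection, and to swap the coordinates
  of the square.\<close>

lemma BijGroup_conj_iso:
  assumes h: "\<And>x. x \<in> A \<Longrightarrow> h x \<in> B" "\<And>x. x \<in> A \<Longrightarrow> k (h x) = x"
    and k: "\<And>y. y \<in> B \<Longrightarrow> k y \<in> A" "\<And>y. y \<in> B \<Longrightarrow> h (k y) = y"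
  shows "(\<lambda>u. \<lambda>y\<in>B. h (u (k y))) \<in> iso (BijGroup A) (BijGroup B)"
proof (rule isoI)
  have bij: "bij_betw h A B" "bij_betw k B A"
    by (auto intro!: bij_betw_byWitness[where f' = k] bij_betw_byWitness[where f' = h] simp: h k)
  have closed: "(\<lambda>y\<in>B. h (u (k y))) \<in> carrier (BijGroup B)" if "u \<in> carrier (BijGroup A)" for u
  proof -
    have "bij_betw (h \<circ> (u \<circ> k)) B B"
      using bij that by (auto simp: carrier_BijGroup_iff intro: bij_betw_trans)
    then show ?thesis
      by (auto simp: carrier_BijGroup_iff cong: bij_betw_cong)
  qed
  have closed': "(\<lambda>y\<in>A. k (u (h y))) \<in> carrier (BijGroup A)" if "u \<in> carrier (BijGroup B)" for u
  proof -
    have "bij_betw (k \<circ> (u \<circ> h)) A A"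
      using bij that by (auto simp: carrier_BijGroup_iff intro: bij_betw_trans)
    then show ?thesis
      by (auto simp: carrier_BijGroup_iff cong: bij_betw_cong)
  qed
  show "(\<lambda>u. \<lambda>y\<in>B. h (u (k y))) \<in> hom (BijGroup A) (BijGroup B)"
  proof (rule homI)
    fix u v assume uv: "u \<in> carrier (BijGroup A)" "v \<in> carrier (BijGroup A)"
    then have "u \<otimes>\<^bsub>BijGroup A\<^esub> v \<in> carrier (BijGroup A)"
      by (simp add: group.is_monoid group_BijGroup monoid.m_closed)
    with uv show "(\<lambda>y\<in>B. h ((u \<otimes>\<^bsub>BijGroup A\<^esub> v) (k y))) =
        (\<lambda>y\<in>B. h (u (k y))) \<otimes>\<^bsub>BijGroup B\<^esub> (\<lambda>y\<in>B. h (v (k y)))"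
      by (intro BijGroup_eqI[of _ B] closed monoid.m_closed group.is_monoid group_BijGroup)
        (auto simp: BijGroup_mult closed BijGroup_closed h k)
  qed (rule closed)
  show "bij_betw (\<lambda>u. \<lambda>y\<in>B. h (u (k y))) (carrier (BijGroup A)) (carrier (BijGroup B))"
  proof (rule bij_betw_byWitness[where f' = "\<lambda>u. \<lambda>y\<in>A. k (u (h y))"])
    show "\<forall>u\<in>carrier (BijGroup A). (\<lambda>y\<in>A. k ((\<lambda>y\<in>B. h (u (k y))) (h y))) = u"
      by (rule ballI, rule BijGroup_eqI[OF closed'[OF closed]]) (simp_all add: h k BijGroup_closed)
    show "\<forall>u\<in>carrier (BijGroup B). (\<lambda>y\<in>B. h ((\<lambda>y\<in>A. k (u (h y))) (k y))) = u"
      by (rule ballI, rule BijGroup_eqI[OF closed[OF closed']]) (simp_all add: h k BijGroup_closed)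
  qed (use closed closed' in blast)+
qed

lemma BijGroup_cong_card:
  assumes "finite A" "finite B" "card A = card B"
  shows "BijGroup A \<cong> BijGroup B"
proof -
  obtain h where h: "bij_betw h A B"
    using assms finite_same_card_bij by blast
  show ?thesis
    by (rule is_isoI, rule BijGroup_conj_iso[where h = h and k = "inv_into A h"])
      (use h bij_betwE bij_betw_inv_into bij_betw_inv_into_left bij_betw_inv_into_right in fast)+
qed

text \<open>The product is taken componentwise, so precomposing with \<open>p\<close> respects it;
  precomposing with the inverse of \<open>p\<close> undoes this. The restrictions to
  \<open>J\<close> and \<open>I\<close> keep the families extensional.\<close>

lemma product_group_reindex:
  assumes p: "bij_betw p J I"
  shows "product_group I (\<lambda>_. G) \<cong> product_group J (\<lambda>_. G)"
proof (rule is_isoI, rule isoI)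
  show "(\<lambda>f. \<lambda>j\<in>J. f (p j)) \<in> hom (product_group I (\<lambda>_. G)) (product_group J (\<lambda>_. G))"
    using bij_betwE[OF p] by (intro homI) (auto simp: PiE_iff fun_eq_iff)
  show "bij_betw (\<lambda>f. \<lambda>j\<in>J. f (p j)) (carrier (product_group I (\<lambda>_. G)))
      (carrier (product_group J (\<lambda>_. G)))"
    by (rule bij_betw_byWitness[where f' = "\<lambda>f. \<lambda>i\<in>I. f (inv_into J p i)"])
      (use bij_betwE[OF p] bij_betwE[OF bij_betw_inv_into[OF p]] in
        \<open>auto simp: PiE_iff fun_eq_iff extensional_def bij_betw_inv_into_left[OF p]
          bij_betw_inv_into_right[OF p]\<close>)
qed

lemma product_BijGroup_cong_sym_power:
  assumes "finite I" "finite A"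
  shows "product_group I (\<lambda>_. BijGroup A) \<cong> sym_power (card A) (card I)"
proof -
  obtain p where p: "bij_betw p {1..card I} I"
    using assms(1) ex_bij_betw_nat_finite_1 by blast
  have "product_group I (\<lambda>_. BijGroup A) \<cong> product_group {1..card I} (\<lambda>_. BijGroup A)"
    by (rule product_group_reindex[OF p])
  also have "\<dots> \<cong> sym_power (card A) (card I)"
    unfolding sym_power_def
    by (intro iso_product_groupI group_BijGroup BijGroup_cong_card) (use assms in auto)
  finally show ?thesis .
qed

section \<open>Families of row permutations\<close>

text \<open>The index \<open>0 \<notin> [n]\<close> carries the permutation shared by the rows outside \<open>P\<close>.\<close>

definition row_families :: "nat \<Rightarrow> nat set \<Rightarrow> (nat \<Rightarrow> nat \<Rightarrow> nat) monoid" where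
  "row_families n P = product_group (insert 0 P) (\<lambda>_. BijGroup ({1..n} - P))"

definition row_perm :: "nat \<Rightarrow> nat set \<Rightarrow> (nat \<Rightarrow> nat \<Rightarrow> nat) \<Rightarrow> nat \<times> nat \<Rightarrow> nat \<times> nat" where
  "row_perm n P f =
    (\<lambda>(k, j)\<in>square n. (k, if j \<in> P then j else f (if k \<in> P then k else 0) j))"

lemma row_families_apply:
  "\<lbrakk>f \<in> carrier (row_families n P); i \<in> insert 0 P\<rbrakk> \<Longrightarrow> f i \<in> carrier (BijGroup ({1..n} - P))"
  by (auto simp: row_families_def PiE_iff)

lemma row_families_closed:
  "\<lbrakk>f \<in> carrier (row_families n P); i \<in> insert 0 P; j \<in> {1..n} - P\<rbrakk> \<Longrightarrow> f i j \<in> {1..n} - P"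
  by (rule BijGroup_closed[OF row_families_apply])

lemma row_families_inj:
  assumes "f \<in> carrier (row_families n P)" "i \<in> insert 0 P" "j \<in> {1..n} - P" "j' \<in> {1..n} - P"
    "f i j = f i j'"
  shows "j = j'"
  using row_families_apply[OF assms(1,2)] assms(3-5)
  by (auto simp: carrier_BijGroup_iff bij_betw_def inj_on_def)

lemma group_row_families: "group (row_families n P)"
  by (simp add: row_families_def group_BijGroup)

lemma row_perm_apply:
  "\<lbrakk>k \<in> {1..n}; j \<in> {1..n}\<rbrakk>
    \<Longrightarrow> row_perm n P f (k, j) = (k, if j \<in> P then j else f (if k \<in> P then k else 0) j)"
  by (simp add: row_perm_def square_def)

lemma row_perm_closed:
  assumes f: "f \<in> carrier (row_families n P)"
  shows "row_perm n P f \<in> carrier (BijGroup (square n))"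
proof -
  \<comment> \<open>The square is finite, so injectivity and stability of the square are enough for
    bijectivity.\<close>
  have "inj_on (row_perm n P f) (square n)"
  proof (rule inj_onI)
    fix x y assume x: "x \<in> square n" and y: "y \<in> square n"
      and eq: "row_perm n P f x = row_perm n P f y"
    obtain k j l m where [simp]: "x = (k, j)" "y = (l, m)"
      by (metis surj_pair)
    have in_n: "k \<in> {1..n}" "j \<in> {1..n}" "l \<in> {1..n}" "m \<in> {1..n}"
      using x y by (auto simp: square_def)
    then have "k = l"
      and *: "(if j \<in> P then j else f (if k \<in> P then k else 0) j) =
        (if m \<in> P then m else f (if k \<in> P then k else 0) m)"
      using eq by (auto simp: row_perm_apply)
    define i where "i = (if k \<in> P then k else 0)"
    have i: "i \<in> insert 0 P"
      by (simp add: i_def)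
    \<comment> \<open>Columns in \<open>P\<close> are fixed and columns outside \<open>P\<close>
      stay outside, so \<open>j\<close> and \<open>m\<close> lie on the same side of
      \<open>P\<close>. Outside \<open>P\<close> the injectivity of \<open>f i\<close>
      decides.\<close>
    have "j = m"
      using * in_n row_families_closed[OF f i, of j] row_families_closed[OF f i, of m]
        row_families_inj[OF f i, of j m]
      unfolding i_def[symmetric] by (auto split: if_splits)
    with \<open>k = l\<close> show "x = y" by simp
  qed
  moreover have "row_perm n P f ` square n \<subseteq> square n"
    using row_families_closed[OF f] by (auto simp: row_perm_def square_def split: if_splits)
  moreover have "finite (square n)"
    by (simp add: square_def)
  ultimately have "bij_betw (row_perm n P f) (square n) (square n)"
    by (simp add: bij_betw_def endo_inj_surj)
  then show ?thesis
    by (simp add: carrier_BijGroup_iff row_perm_def)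
qed

text \<open>Rows are preserved, so the same index \<open>i\<close> governs both factors of a
  composition. It then remains to compose within one row.\<close>

lemma row_perm_hom:
  "row_perm n P \<in> hom (row_families n P) (BijGroup (square n))"
proof (rule homI)
  fix f g assume fg: "f \<in> carrier (row_families n P)" "g \<in> carrier (row_families n P)"
  let ?m = "f \<otimes>\<^bsub>row_families n P\<^esub> g"
  have m: "?m \<in> carrier (row_families n P)"
    by (intro monoid.m_closed group.is_monoid group_row_families fg)
  have m_apply: "?m i j = f i (g i j)" if "i \<in> insert 0 P" "j \<in> {1..n} - P" for i j
    using that row_families_apply[OF fg(1) that(1)] row_families_apply[OF fg(2) that(1)]
    by (simp add: row_families_def BijGroup_mult)
  show "row_perm n P ?m = row_perm n P f \<otimes>\<^bsub>BijGroup (square n)\<^esub> row_perm n P g"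
  proof (rule BijGroup_eqI[of _ "square n"])
    fix x assume "x \<in> square n"
    then obtain k j where x: "x = (k, j)" and kj: "k \<in> {1..n}" "j \<in> {1..n}"
      by (auto simp: square_def)
    define i where "i = (if k \<in> P then k else 0)"
    have i: "i \<in> insert 0 P"
      by (simp add: i_def)
    have apply_row: "row_perm n P f' (k, j') = (k, if j' \<in> P then j' else f' i j')"
      if "j' \<in> {1..n}" for f' j'
      using row_perm_apply[OF kj(1) that] by (simp only: i_def)
    have "row_perm n P ?m x = row_perm n P f (row_perm n P g x)"
    proof (cases "j \<in> P")
      case True
      with kj show ?thesis by (simp add: x apply_row)
    next
      case False
      with kj have j: "j \<in> {1..n} - P" by simp
      \<comment> \<open>The column reached after the first factor is again outside \<open>P\<close>,
        so the second factor moves it by \<open>f i\<close> and does not fix it.\<close>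
      have "g i j \<in> {1..n}" "g i j \<notin> P"
        using row_families_closed[OF fg(2) i j] by auto
      then have "row_perm n P f (row_perm n P g x) = (k, f i (g i j))"
        using kj False by (simp only: x apply_row if_False)
      also have "\<dots> = row_perm n P ?m x"
        using kj False by (simp only: x apply_row if_False m_apply[OF i j])
      finally show ?thesis ..
    qed
    then show "row_perm n P ?m x = (row_perm n P f \<otimes>\<^bsub>BijGroup (square n)\<^esub> row_perm n P g) x"
      using fg \<open>x \<in> square n\<close> by (simp only: BijGroup_mult row_perm_closed)
  next
    show "row_perm n P ?m \<in> carrier (BijGroup (square n))"
      by (rule row_perm_closed[OF m])
    show "row_perm n P f \<otimes>\<^bsub>BijGroup (square n)\<^esub> row_perm n P g \<in> carrier (BijGroup (square n))"
      by (intro monoid.m_closed group.is_monoid group_BijGroup row_perm_closed fg)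
  qed
qed (rule row_perm_closed)

text \<open>Every component of the family can be read off from some row. If \<open>P\<close> is all
  of \<open>[n]\<close>, each component is the only permutation of the empty set.\<close>

lemma row_perm_inj:
  assumes P: "P \<subseteq> {1..n}"
  shows "inj_on (row_perm n P) (carrier (row_families n P))"
proof (rule inj_onI)
  fix f g assume f: "f \<in> carrier (row_families n P)" and g: "g \<in> carrier (row_families n P)"
    and eq: "row_perm n P f = row_perm n P g"
  have "f i = g i" if i: "i \<in> insert 0 P" for i
  proof (rule BijGroup_eqI[OF row_families_apply[OF f i] row_families_apply[OF g i]])
    fix j assume j: "j \<in> {1..n} - P"
    \<comment> \<open>A row governed by index \<open>i\<close> is wanted. For the shared index 0
      this must be a row outside \<open>P\<close>, and the number \<open>j\<close>, being a column
      outside \<open>P\<close>, also names such a row.\<close>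
    define k where "k = (if i \<in> P then i else j)"
    have k: "k \<in> {1..n}" "(if k \<in> P then k else 0) = i"
      using i j P by (auto simp: k_def)
    then show "f i j = g i j"
      using j fun_cong[OF eq, of "(k, j)"] by (simp add: row_perm_apply)
  qed
  then show "f = g"
    using f g by (intro extensionalityI[of f "insert 0 P"]) (auto simp: row_families_def PiE_iff)
qed

section \<open>The generated subgroup as the image of the row families\<close>

lemma R_check_R_subset_rows:
  assumes P: "P \<subseteq> {1..n}"
  shows "R_check n P \<union> R n P \<subseteq> row_perm n P ` carrier (row_families n P)"
proof
  let ?Q = "{1..n} - P"
  have in_image: "u \<in> row_perm n P ` carrier (row_families n P)"
    if u: "u \<in> carrier (BijGroup (square n))" and f: "f \<in> carrier (row_families n P)"
      and ptw: "\<And>k j. \<lbrakk>k \<in> {1..n}; j \<in> {1..n}\<rbrakk>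
        \<Longrightarrow> u (k, j) = (k, if j \<in> P then j else f (if k \<in> P then k else 0) j)" for u f
  proof (rule image_eqI[OF _ f], rule BijGroup_eqI[OF u row_perm_closed[OF f]])
    fix x assume "x \<in> square n"
    then show "u x = row_perm n P f x"
      using ptw by (auto simp: square_def row_perm_apply)
  qed
  have one: "\<one>\<^bsub>BijGroup ?Q\<^esub> \<in> carrier (BijGroup ?Q)"
    by (simp add: group.is_monoid group_BijGroup)
  fix u assume "u \<in> R_check n P \<union> R n P"
  then consider "u \<in> R_check n P" | "u \<in> R n P" by blast
  then show "u \<in> row_perm n P ` carrier (row_families n P)"
  proof cases
    case 1
    then obtain \<sigma> where \<sigma>: "\<sigma> \<in> carrier (BijGroup ?Q)"
      "\<And>k j. \<lbrakk>k \<in> ?Q; j \<in> ?Q\<rbrakk> \<Longrightarrow> u (k, j) = (k, \<sigma> j)"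
      by (auto simp: R_check_def)
    \<comment> \<open>For \<open>u\<close> in \<open>R_check\<close> the rows outside
      \<open>P\<close> share \<sigma> and the rows in \<open>P\<close> are fixed. As 0 is not in
      \<open>P\<close>, the test \<open>i = 0\<close> singles out the shared index.\<close>
    let ?f = "\<lambda>i\<in>insert 0 P. if i = 0 then \<sigma> else \<one>\<^bsub>BijGroup ?Q\<^esub>"
    show ?thesis
    proof (rule in_image[of _ ?f])
      show "?f \<in> carrier (row_families n P)"
        using \<sigma>(1) one by (auto simp: row_families_def)
    qed (use 1 P \<sigma> in \<open>auto simp: R_check_def BijGroup_one\<close>)
  next
    case 2
    \<comment> \<open>For \<open>u\<close> in \<open>R\<close> the shared permutation is trivial,
      and the component at \<open>i\<close> in \<open>P\<close> is the action of \<open>u\<close> on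
      the columns of row \<open>i\<close>. It is a permutation because \<open>u\<close> is injective
      and maps that part of the row onto itself.\<close>
    let ?f = "\<lambda>i\<in>insert 0 P. if i = 0 then \<one>\<^bsub>BijGroup ?Q\<^esub> else (\<lambda>j\<in>?Q. snd (u (i, j)))"
    have row: "(\<lambda>j\<in>?Q. snd (u (k, j))) \<in> carrier (BijGroup ?Q)"
      and fst: "\<And>j. j \<in> ?Q \<Longrightarrow> u (k, j) = (k, snd (u (k, j)))" if k: "k \<in> P" for k
    proof -
      have img: "u ` ({k} \<times> ?Q) = {k} \<times> ?Q"
        using 2 k by (auto simp: R_def)
      show fst: "u (k, j) = (k, snd (u (k, j)))" if "j \<in> ?Q" for j
      proof -
        have "u (k, j) \<in> {k} \<times> ?Q"
          using img that by blast
        then show ?thesis by auto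
      qed
      have "inj_on u (square n)"
        using 2 by (auto simp: R_def carrier_BijGroup_iff bij_betw_def)
      moreover have "(k, j) \<in> square n" if "j \<in> ?Q" for j
        using that k P by (auto simp: square_def)
      ultimately have "(k, j) = (k, j')"
        if "j \<in> ?Q" "j' \<in> ?Q" "snd (u (k, j)) = snd (u (k, j'))" for j j'
        using that fst[OF that(1)] fst[OF that(2)] by (metis inj_onD)
      then have "inj_on (\<lambda>j. snd (u (k, j))) ?Q"
        by (intro inj_onI) simp
      moreover have "(\<lambda>j. snd (u (k, j))) ` ?Q = ?Q"
      proof -
        have "(\<lambda>j. snd (u (k, j))) ` ?Q = snd ` (u ` ({k} \<times> ?Q))"
          by force
        then show ?thesis
          by (simp only: img) force
      qed
      ultimately show "(\<lambda>j\<in>?Q. snd (u (k, j))) \<in> carrier (BijGroup ?Q)"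
        by (auto simp: carrier_BijGroup_iff bij_betw_def)
    qed
    show ?thesis
    proof (rule in_image[of _ ?f])
      show "?f \<in> carrier (row_families n P)"
        using row one by (auto simp: row_families_def)
      fix k j assume "k \<in> {1..n}" "j \<in> {1..n}"
      then show "u (k, j) = (k, if j \<in> P then j else ?f (if k \<in> P then k else 0) j)"
        using 2 P fst[of k j] by (auto simp: R_def BijGroup_one)
    qed (use 2 in \<open>auto simp: R_def\<close>)
  qed
qed

text \<open>The witness for \<sigma> is \<open>f 0\<close>. This lemma and the next one recognise
  the two factors into which an arbitrary family is split.\<close>

lemma row_perm_shared_in_R_check:
  assumes P: "P \<subseteq> {1..n}" and f: "f \<in> carrier (row_families n P)"
    and triv: "\<And>i. i \<in> P \<Longrightarrow> f i = \<one>\<^bsub>BijGroup ({1..n} - P)\<^esub>"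
  shows "row_perm n P f \<in> R_check n P"
  using P row_perm_closed[OF f] row_families_apply[OF f, of 0]
  by (auto simp: R_check_def row_perm_apply triv BijGroup_one)

lemma row_perm_unshared_in_R:
  assumes P: "P \<subseteq> {1..n}" and f: "f \<in> carrier (row_families n P)"
    and triv: "f 0 = \<one>\<^bsub>BijGroup ({1..n} - P)\<^esub>"
  shows "row_perm n P f \<in> R n P"
proof -
  have "row_perm n P f ` ({k} \<times> ({1..n} - P)) = {k} \<times> ({1..n} - P)" if k: "k \<in> P" for k
  proof -
    have "row_perm n P f ` ({k} \<times> ({1..n} - P)) = {k} \<times> f k ` ({1..n} - P)"
      using k P by (force simp: row_perm_def square_def image_iff)
    also have "f k ` ({1..n} - P) = {1..n} - P"
      using row_families_apply[OF f, of k] k by (auto simp: carrier_BijGroup_iff bij_betw_def)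
    finally show ?thesis .
  qed
  then show ?thesis
    using row_perm_closed[OF f] by (auto simp: R_def row_perm_apply triv BijGroup_one)
qed

text \<open>The image of a homomorphism is a subgroup, and it contains the generators. Conversely, a
  family is the product of its part at index 0 and its part on \<open>P\<close>, which map into
  \<open>R_check\<close> and \<open>R\<close> respectively.\<close>

lemma generate_rows:
  assumes P: "P \<subseteq> {1..n}"
  shows "generate (BijGroup (square n)) (R_check n P \<union> R n P) =
    row_perm n P ` carrier (row_families n P)"
proof
  interpret S: group "BijGroup (square n)"
    by (rule group_BijGroup)
  interpret K: group "row_families n P"
    by (rule group_row_families)
  interpret group_hom "row_families n P" "BijGroup (square n)" "row_perm n P"
    by unfold_locales (rule row_perm_hom)
  show "generate (BijGroup (square n)) (R_check n P \<union> R n P) \<subseteq>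
      row_perm n P ` carrier (row_families n P)"
    by (rule S.generate_subgroup_incl[OF R_check_R_subset_rows[OF P] img_is_subgroup])
  show "row_perm n P ` carrier (row_families n P) \<subseteq>
      generate (BijGroup (square n)) (R_check n P \<union> R n P)"
  proof
    let ?Q = "{1..n} - P"
    interpret Q: group "BijGroup ?Q"
      by (rule group_BijGroup)
    fix u assume "u \<in> row_perm n P ` carrier (row_families n P)"
    then obtain f where u: "u = row_perm n P f" and f: "f \<in> carrier (row_families n P)"
      by blast
    define g where "g = (\<lambda>i\<in>insert 0 P. if i = 0 then f 0 else \<one>\<^bsub>BijGroup ?Q\<^esub>)"
    define h where "h = (\<lambda>i\<in>insert 0 P. if i = 0 then \<one>\<^bsub>BijGroup ?Q\<^esub> else f i)"
    \<comment> \<open>Since the shared index is not a row of \<open>P\<close>, all components of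
      \<open>g\<close> on \<open>P\<close> are trivial, and in \<open>g\<close> times
      \<open>h\<close> each component has at least one trivial factor.\<close>
    have 0: "0 \<notin> P" using P by auto
    have g: "g \<in> carrier (row_families n P)" and h: "h \<in> carrier (row_families n P)"
      using f Q.one_closed by (auto simp: g_def h_def row_families_def PiE_iff)
    have "f = g \<otimes>\<^bsub>row_families n P\<^esub> h"
      using f Q.l_one Q.r_one 0
      by (intro extensionalityI[of f "insert 0 P"]) (auto simp: row_families_def g_def h_def PiE_iff)
    then have "u = row_perm n P g \<otimes>\<^bsub>BijGroup (square n)\<^esub> row_perm n P h"
      using u g h by simp
    moreover have "row_perm n P g \<in> R_check n P"
      using 0 by (intro row_perm_shared_in_R_check P g) (auto simp: g_def)
    moreover have "row_perm n P h \<in> R n P"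
      by (intro row_perm_unshared_in_R P h) (auto simp: h_def)
    ultimately show "u \<in> generate (BijGroup (square n)) (R_check n P \<union> R n P)"
      by (auto intro: generate.eng generate.incl)
  qed
qed

text \<open>An injective homomorphism is an isomorphism onto its image, which is the generated
  subgroup. The families form a power of S([n] - P), and the index 0, being outside
  \<open>P\<close>, supplies the extra factor in the exponent.\<close>

lemma generate_rows_iso:
  assumes P: "P \<subseteq> {1..n}"
  shows "(BijGroup (square n))\<lparr>carrier := generate (BijGroup (square n)) (R_check n P \<union> R n P)\<rparr>
    \<cong> sym_power (n - card P) (card P + 1)"
proof -
  have "row_perm n P \<in> iso (row_families n P)
      ((BijGroup (square n))\<lparr>carrier := row_perm n P ` carrier (row_families n P)\<rparr>)"
    using row_perm_hom[of n P] row_perm_inj[OF P] by (auto simp: iso_def hom_def bij_betw_def)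
  then have "(BijGroup (square n))\<lparr>carrier := generate (BijGroup (square n)) (R_check n P \<union> R n P)\<rparr>
      \<cong> row_families n P"
    unfolding generate_rows[OF P] by (intro group.iso_sym[OF group_row_families] is_isoI)
  also have "\<dots> \<cong> sym_power (card ({1..n} - P)) (card (insert 0 P))"
    unfolding row_families_def
    using P finite_subset by (intro product_BijGroup_cong_sym_power) auto
  also have "card ({1..n} - P) = n - card P"
    using P finite_subset[OF P] by (simp add: card_Diff_subset)
  also have "card (insert 0 P) = card P + 1"
    using P finite_subset[OF P] by (subst card_insert_disjoint) auto
  finally show ?thesis .
qed

section \<open>Compatibility\<close>

text \<open>The product of \<open>BijGroup (cube n)\<close> is composition only on its carrier, so
  membership has to be known before compatibility can be evaluated. The cube is finite, hence
  injectivity suffices; it is inherited from \<open>u\<close> on the pair of coordinates on which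
  \<open>u\<close> acts.\<close>

lemma tensor_closed:
  assumes u: "u \<in> carrier (BijGroup (square n))"
  shows "tensor21 n u \<one>\<^bsub>BijGroup {1..n}\<^esub> \<in> carrier (BijGroup (cube n))"
    and "tensor12 n \<one>\<^bsub>BijGroup {1..n}\<^esub> u \<in> carrier (BijGroup (cube n))"
proof -
  have inj: "\<And>x y. \<lbrakk>x \<in> square n; y \<in> square n; u x = u y\<rbrakk> \<Longrightarrow> x = y"
    using u by (auto simp: carrier_BijGroup_iff bij_betw_def inj_on_def)
  have closed: "fst (u (a, b)) \<in> {1..n} \<and> snd (u (a, b)) \<in> {1..n}"
    if "a \<in> {1..n}" "b \<in> {1..n}" for a b
    using BijGroup_closed[OF u, of "(a, b)"] that by (auto simp: square_def mem_Times_iff)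
  have fin: "finite (cube n)"
    by (simp add: cube_def)
  have bij: "bij_betw t (cube n) (cube n)" if "inj_on t (cube n)" "t ` cube n \<subseteq> cube n" for t
    using endo_inj_surj[OF fin that(2,1)] that(1) by (simp add: bij_betw_def)
  have "bij_betw (tensor21 n u \<one>\<^bsub>BijGroup {1..n}\<^esub>) (cube n) (cube n)"
  proof (rule bij)
    show "inj_on (tensor21 n u \<one>\<^bsub>BijGroup {1..n}\<^esub>) (cube n)"
    proof (rule inj_onI)
      fix x y assume "x \<in> cube n" "y \<in> cube n" "tensor21 n u \<one>\<^bsub>BijGroup {1..n}\<^esub> x = tensor21 n u \<one>\<^bsub>BijGroup {1..n}\<^esub> y"
      moreover obtain a b c a' b' c' where "x = (a, b, c)" "y = (a', b', c')"
        by (metis surj_pair)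
      ultimately show "x = y"
        using inj[of "(a, b)" "(a', b')"]
        by (auto simp: tensor21_def cube_def square_def BijGroup_one prod_eq_iff)
    qed
    show "tensor21 n u \<one>\<^bsub>BijGroup {1..n}\<^esub> ` cube n \<subseteq> cube n"
      using closed by (auto simp: tensor21_def cube_def BijGroup_one)
  qed
  then show "tensor21 n u \<one>\<^bsub>BijGroup {1..n}\<^esub> \<in> carrier (BijGroup (cube n))"
    by (simp add: carrier_BijGroup_iff tensor21_def)
  have "bij_betw (tensor12 n \<one>\<^bsub>BijGroup {1..n}\<^esub> u) (cube n) (cube n)"
  proof (rule bij)
    show "inj_on (tensor12 n \<one>\<^bsub>BijGroup {1..n}\<^esub> u) (cube n)"
    proof (rule inj_onI)
      fix x y assume "x \<in> cube n" "y \<in> cube n" "tensor12 n \<one>\<^bsub>BijGroup {1..n}\<^esub> u x = tensor12 n \<one>\<^bsub>BijGroup {1..n}\<^esub> u y"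
      moreover obtain a b c a' b' c' where "x = (a, b, c)" "y = (a', b', c')"
        by (metis surj_pair)
      ultimately show "x = y"
        using inj[of "(b, c)" "(b', c')"]
        by (auto simp: tensor12_def cube_def square_def BijGroup_one)
    qed
    show "tensor12 n \<one>\<^bsub>BijGroup {1..n}\<^esub> u ` cube n \<subseteq> cube n"
      using closed by (auto simp: tensor12_def cube_def BijGroup_one) (metis fst_conv snd_conv)+
  qed
  then show "tensor12 n \<one>\<^bsub>BijGroup {1..n}\<^esub> u \<in> carrier (BijGroup (cube n))"
    by (simp add: carrier_BijGroup_iff tensor12_def)
qed

text \<open>Both products are evaluated at \<open>(a, b, c)\<close>. With
  \<open>u (b, c) = (d, e)\<close> and \<open>v (a, b) = (p, q)\<close>, one side is
  \<open>v (a, d)\<close> followed by \<open>e\<close>, the other is \<open>p\<close> followed by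
  \<open>u (q, c)\<close>. The first two coordinates give the first equation, the third gives the
  second.\<close>

lemma compatible_iff:
  assumes u: "u \<in> carrier (BijGroup (square n))" and v: "v \<in> carrier (BijGroup (square n))"
  shows "compatible n u v \<longleftrightarrow> (\<forall>a\<in>{1..n}. \<forall>b\<in>{1..n}. \<forall>c\<in>{1..n}.
    v (a, fst (u (b, c))) = (fst (v (a, b)), fst (u (snd (v (a, b)), c))) \<and>
    snd (u (b, c)) = snd (u (snd (v (a, b)), c)))"
    (is "_ \<longleftrightarrow> ?rhs")
proof -
  let ?V = "tensor21 n v \<one>\<^bsub>BijGroup {1..n}\<^esub>" and ?U = "tensor12 n \<one>\<^bsub>BijGroup {1..n}\<^esub> u"
  note VU = tensor_closed(1)[OF v] tensor_closed(2)[OF u]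
  have mult: "?V \<otimes>\<^bsub>BijGroup (cube n)\<^esub> ?U \<in> carrier (BijGroup (cube n))"
    "?U \<otimes>\<^bsub>BijGroup (cube n)\<^esub> ?V \<in> carrier (BijGroup (cube n))"
    using VU by (simp_all add: group.is_monoid group_BijGroup monoid.m_closed)
  have "compatible n u v \<longleftrightarrow> (\<forall>x\<in>cube n. ?V (?U x) = ?U (?V x))"
    unfolding compatible_def
    using BijGroup_eqI[OF mult] BijGroup_mult[OF VU] BijGroup_mult[OF VU(2,1)] by metis
  also have "\<dots> \<longleftrightarrow> ?rhs"
  proof -
    have "?V (?U (a, b, c)) = ?U (?V (a, b, c)) \<longleftrightarrow>
        v (a, fst (u (b, c))) = (fst (v (a, b)), fst (u (snd (v (a, b)), c))) \<and>
        snd (u (b, c)) = snd (u (snd (v (a, b)), c))"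
      if abc: "a \<in> {1..n}" "b \<in> {1..n}" "c \<in> {1..n}" for a b c
    proof -
      have U: "?U (a, b, c) = (a, u (b, c))"
        and V: "?V (a, b, c) = (fst (v (a, b)), snd (v (a, b)), c)"
        using abc by (simp_all add: tensor12_def tensor21_def cube_def BijGroup_one)
      obtain d e where d: "u (b, c) = (d, e)" "d \<in> {1..n}" "e \<in> {1..n}"
        using BijGroup_closed[OF u, of "(b, c)"] abc by (auto simp: square_def)
      obtain p q where p: "v (a, b) = (p, q)" "p \<in> {1..n}" "q \<in> {1..n}"
        using BijGroup_closed[OF v, of "(a, b)"] abc by (auto simp: square_def)
      have "?V (a, d, e) = (fst (v (a, d)), snd (v (a, d)), e)" "?U (p, q, c) = (p, u (q, c))"
        using abc d p by (simp_all add: tensor12_def tensor21_def cube_def BijGroup_one)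
      then show ?thesis
        unfolding U V d(1) p(1) fst_conv snd_conv by (auto simp: prod_eq_iff)
    qed
    then show ?thesis
      by (auto simp: cube_def)
  qed
  finally show ?thesis .
qed

lemma row_perm_compatible:
  assumes f: "f \<in> carrier (row_families n P)" and g: "g \<in> carrier (row_families n P)"
  shows "compatible n (row_perm n P f) (row_perm n P g)"
  unfolding compatible_iff[OF row_perm_closed[OF f] row_perm_closed[OF g]]
proof (intro ballI)
  fix a b c assume abc: "a \<in> {1..n}" "b \<in> {1..n}" "c \<in> {1..n}"
  \<comment> \<open>The middle coordinate is a column for the \<open>g\<close> permutation and a row
    for the \<open>f\<close> permutation. Its new value \<open>b'\<close> equals \<open>b\<close> if
    \<open>b\<close> is in \<open>P\<close>, and otherwise both are outside \<open>P\<close> and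
    select index 0, so the same component of \<open>f\<close> acts on \<open>c\<close>.\<close>
  define b' where "b' = (if b \<in> P then b else g (if a \<in> P then a else 0) b)"
  have b': "b' \<in> {1..n}" "(if b' \<in> P then b' else 0) = (if b \<in> P then b else 0)"
    using abc row_families_closed[OF g, of "if a \<in> P then a else 0" b] by (auto simp: b'_def)
  have "row_perm n P g (a, b) = (a, b')"
    using abc by (simp add: row_perm_apply b'_def)
  then show "row_perm n P g (a, fst (row_perm n P f (b, c))) =
      (fst (row_perm n P g (a, b)), fst (row_perm n P f (snd (row_perm n P g (a, b)), c))) \<and>
      snd (row_perm n P f (b, c)) = snd (row_perm n P f (snd (row_perm n P g (a, b)), c))"
    using abc b' by (simp add: row_perm_apply)
qed

lemma R_check_R_subset_carrier: "R_check n P \<union> R n P \<subseteq> carrier (BijGroup (square n))"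
  by (auto simp: R_def R_check_def)

lemma generate_rows_bicompatible:
  assumes P: "P \<subseteq> {1..n}"
  shows "bicompatible_subgroup n (generate (BijGroup (square n)) (R_check n P \<union> R n P))"
  unfolding bicompatible_subgroup_def
proof
  show "subgroup (generate (BijGroup (square n)) (R_check n P \<union> R n P)) (BijGroup (square n))"
    by (intro group.generate_is_subgroup group_BijGroup R_check_R_subset_carrier)
qed (auto simp: generate_rows[OF P] bicompatible_def row_perm_compatible)

section \<open>Exchanging rows and columns\<close>

definition transp :: "nat \<Rightarrow> (nat \<times> nat \<Rightarrow> nat \<times> nat) \<Rightarrow> nat \<times> nat \<Rightarrow> nat \<times> nat" where
  "transp n u = (\<lambda>x\<in>square n. prod.swap (u (prod.swap x)))"

lemma transp_iso: "transp n \<in> iso (BijGroup (square n)) (BijGroup (square n))"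
  unfolding transp_def by (rule BijGroup_conj_iso) (auto simp: square_def)

lemma transp_closed:
  "u \<in> carrier (BijGroup (square n)) \<Longrightarrow> transp n u \<in> carrier (BijGroup (square n))"
  using transp_iso iso_imp_homomorphism hom_in_carrier by metis

lemma transp_apply:
  "\<lbrakk>a \<in> {1..n}; b \<in> {1..n}\<rbrakk> \<Longrightarrow> transp n u (a, b) = prod.swap (u (b, a))"
  by (simp add: transp_def square_def)

lemma transp_transp:
  "u \<in> carrier (BijGroup (square n)) \<Longrightarrow> transp n (transp n u) = u"
  by (rule BijGroup_eqI[OF transp_closed[OF transp_closed]]) (auto simp: transp_def square_def)

text \<open>Conjugating by the reversal of triples turns \<open>v\<close> tensor 1 into 1 tensor
  \<open>transp n v\<close>, and 1 tensor \<open>u\<close> into \<open>transp n u\<close> tensor 1.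
  Hence the two arguments change places.\<close>

lemma compatible_transp:
  assumes u: "u \<in> carrier (BijGroup (square n))" and v: "v \<in> carrier (BijGroup (square n))"
    and "compatible n u v"
  shows "compatible n (transp n v) (transp n u)"
  unfolding compatible_iff[OF transp_closed[OF v] transp_closed[OF u]]
proof (intro ballI)
  fix a b c assume abc: "a \<in> {1..n}" "b \<in> {1..n}" "c \<in> {1..n}"
  \<comment> \<open>The given compatibility is used at the reversed triple
    \<open>(c, b, a)\<close>.\<close>
  then have *: "v (c, fst (u (b, a))) = (fst (v (c, b)), fst (u (snd (v (c, b)), a)))"
    "snd (u (b, a)) = snd (u (snd (v (c, b)), a))"
    using assms(3) unfolding compatible_iff[OF u v] by blast+
  have "fst (u (b, a)) \<in> {1..n}" "snd (v (c, b)) \<in> {1..n}"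
    using abc BijGroup_closed[OF u, of "(b, a)"] BijGroup_closed[OF v, of "(c, b)"]
    by (auto simp: square_def mem_Times_iff)
  with abc * show "transp n u (a, fst (transp n v (b, c))) =
      (fst (transp n u (a, b)), fst (transp n v (snd (transp n u (a, b)), c))) \<and>
      snd (transp n v (b, c)) = snd (transp n v (snd (transp n u (a, b)), c))"
    by (simp add: transp_apply prod_eq_iff)
qed

text \<open>The part of row \<open>k\<close> outside \<open>P\<close> is the swap of the
  corresponding part of column \<open>k\<close>. The swap is injective, so it cancels from an
  equality of images and the row condition becomes the column condition.\<close>

lemma transp_in_R_iff:
  assumes P: "P \<subseteq> {1..n}" and u: "u \<in> carrier (BijGroup (square n))"
  shows "transp n u \<in> R n P \<longleftrightarrow> u \<in> C n P"
proof -
  have "transp n u ` ({k} \<times> ({1..n} - P)) = prod.swap ` (u ` (({1..n} - P) \<times> {k}))" if "k \<in> P" for k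
  proof -
    have "{k} \<times> ({1..n} - P) = prod.swap ` (({1..n} - P) \<times> {k})"
      by auto
    moreover have "transp n u (prod.swap x) = prod.swap (u x)" if "x \<in> ({1..n} - P) \<times> {k}" for x
      using that \<open>k \<in> P\<close> P by (auto simp: transp_def square_def)
    ultimately show ?thesis
      by (simp add: image_image cong: image_cong_simp)
  qed
  moreover have "{k} \<times> ({1..n} - P) = prod.swap ` (({1..n} - P) \<times> {k})" for k :: nat
    by auto
  ultimately have "transp n u ` ({k} \<times> ({1..n} - P)) = {k} \<times> ({1..n} - P) \<longleftrightarrow>
      u ` (({1..n} - P) \<times> {k}) = ({1..n} - P) \<times> {k}" if "k \<in> P" for k
    using that by (metis inj_image_eq_iff inj_swap)
  then show ?thesis
    using u transp_closed[OF u] by (auto simp: R_def C_def transp_apply prod_eq_iff)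
qed

lemma transp_in_R_check_iff:
  assumes u: "u \<in> carrier (BijGroup (square n))"
  shows "transp n u \<in> R_check n P \<longleftrightarrow> u \<in> C_check n P"
  using u transp_closed[OF u] by (auto simp: R_check_def C_check_def transp_apply prod_eq_iff)

text \<open>Because \<open>transp n\<close> is an involution, the two membership equivalences yield
  both inclusions.\<close>

lemma columns_eq_transp_rows:
  assumes P: "P \<subseteq> {1..n}"
  shows "C_check n P \<union> C n P = transp n ` (R_check n P \<union> R n P)"
proof (intro subset_antisym subsetI)
  fix u assume u: "u \<in> C_check n P \<union> C n P"
  then have "u \<in> carrier (BijGroup (square n))"
    by (auto simp: C_def C_check_def)
  with u show "u \<in> transp n ` (R_check n P \<union> R n P)"
    by (intro image_eqI[of _ _ "transp n u"])
      (auto simp: transp_transp transp_in_R_iff[OF P] transp_in_R_check_iff)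
next
  fix u assume "u \<in> transp n ` (R_check n P \<union> R n P)"
  then obtain w where w: "u = transp n w" "w \<in> R_check n P \<union> R n P"
    by blast
  then have "w \<in> carrier (BijGroup (square n))"
    using R_check_R_subset_carrier by blast
  with w show "u \<in> C_check n P \<union> C n P"
    using transp_in_R_iff[OF P, of u] transp_in_R_check_iff[of u n P]
    by (auto simp: transp_transp transp_closed)
qed

theorem theorem4p1:
  fixes n :: nat and P :: "nat set"
  assumes "P \<subseteq> {1..n}"
  shows "bicompatible_subgroup n (generate (BijGroup (square n)) (R_check n P \<union> R n P)) \<and>
    (BijGroup (square n))\<lparr>carrier := generate (BijGroup (square n)) (R_check n P \<union> R n P)\<rparr>
      \<cong> sym_power (n - card P) (card P + 1) \<and>
    bicompatible_subgroup n (generate (BijGroup (square n)) (C_check n P \<union> C n P)) \<and>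
    (BijGroup (square n))\<lparr>carrier := generate (BijGroup (square n)) (C_check n P \<union> C n P)\<rparr>
      \<cong> sym_power (n - card P) (card P + 1)"
proof -
  let ?S = "BijGroup (square n)"
  let ?H = "generate ?S (R_check n P \<union> R n P)" and ?K = "generate ?S (C_check n P \<union> C n P)"
  interpret S: group ?S
    by (rule group_BijGroup)
  interpret group_hom ?S ?S "transp n"
    by unfold_locales (rule iso_imp_homomorphism[OF transp_iso])
  note rows = generate_rows_bicompatible[OF assms] generate_rows_iso[OF assms]
  have H: "subgroup ?H ?S" "\<And>u v. \<lbrakk>u \<in> ?H; v \<in> ?H\<rbrakk> \<Longrightarrow> bicompatible n u v"
    using rows(1) by (auto simp: bicompatible_subgroup_def)
  note H_carrier = subgroup.mem_carrier[OF H(1)]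
  \<comment> \<open>A homomorphism maps the subgroup generated by a set onto the subgroup generated
    by the image of that set.\<close>
  have K: "?K = transp n ` ?H"
    unfolding columns_eq_transp_rows[OF assms] by (rule generate_img[OF R_check_R_subset_carrier])
  \<comment> \<open>Transposition exchanges the arguments of compatibility, which is harmless
    because bicompatibility is symmetric in them.\<close>
  have "bicompatible_subgroup n ?K"
    unfolding bicompatible_subgroup_def
  proof
    show "subgroup ?K ?S"
      unfolding K by (rule subgroup_img_is_subgroup[OF H(1)])
  qed (use H(2) H_carrier in \<open>auto simp: K bicompatible_def compatible_transp\<close>)
  \<comment> \<open>The automorphism restricts to an isomorphism of the row subgroup onto the column
    subgroup, which carries over the isomorphism type.\<close>
  moreover have "transp n \<in> iso (?S\<lparr>carrier := ?H\<rparr>) (?S\<lparr>carrier := ?K\<rparr>)"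
  proof (rule isoI)
    show "transp n \<in> hom (?S\<lparr>carrier := ?H\<rparr>) (?S\<lparr>carrier := ?K\<rparr>)"
      using H_carrier by (intro homI) (auto simp: K)
    have "inj_on (transp n) ?H"
      using H_carrier by (metis inj_on_inverseI transp_transp)
    then show "bij_betw (transp n) (carrier (?S\<lparr>carrier := ?H\<rparr>)) (carrier (?S\<lparr>carrier := ?K\<rparr>))"
      by (simp add: bij_betw_def K)
  qed
  then have "?S\<lparr>carrier := ?K\<rparr> \<cong> sym_power (n - card P) (card P + 1)"
    using group.iso_sym[OF subgroup.subgroup_is_group[OF H(1) S.is_group] is_isoI] rows(2)
      iso_trans by blast
  ultimately show ?thesis
    using rows by simp
qed

end
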